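(* Let $\mathcal{A}$ be a unital simple C$^*$-algebra admitting a faithful tracial state $\tau$. Let $\phi:\mathcal{A}\to\mathcal{A}$ be a map (not assumed linear, additive or continuous) such that for any $a,b\in\mathcal{A}$ there is a linear derivation $D_{a,b}:\mathcal{A}\to\mathcal{A}$ with $$\phi(a)b+a\phi(b)=D_{a,b}(ab).$$ Then $\phi$ is a linear derivation.
   Context: A linear derivation of $\mathcal{A}$ is a linear map $D:\mathcal{A}\to\mathcal{A}$ with $D(ab)=D(a)b+aD(b)$ for all $a,b\in\mathcal{A}$. A faithful tracial state is a positive linear functional $\tau$ with $\tau(1)=1$, $\tau(ab)=\tau(ba)$ for all $a,b$, and $\tau(x^*x)=0$ only if $x=0$. *)

theory Defs
  imports "HOL-Analysis.Analysis"
begin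

text \<open>Isabelle/HOL has no class of complex normed algebras, so a unital complex
Banach algebra is modelled as a real unital Banach algebra (type class
real_normed_algebra_1 + banach) together with a complex scalar multiplication
sm extending scaleR, and an involution star.\<close>

definition complex_algebra_scalar :: "(complex \<Rightarrow> 'a::{real_normed_algebra_1,banach} \<Rightarrow> 'a) \<Rightarrow> bool" where
  "complex_algebra_scalar sm \<longleftrightarrow>
     (\<forall>r x. sm (complex_of_real r) x = scaleR r x) \<and>
     (\<forall>c d x. sm (c + d) x = sm c x + sm d x) \<and>
     (\<forall>c x y. sm c (x + y) = sm c x + sm c y) \<and>
     (\<forall>c d x. sm (c * d) x = sm c (sm d x)) \<and>
     (\<forall>c x y. sm c (x * y) = sm c x * y) \<and>
     (\<forall>c x y. sm c (x * y) = x * sm c y) \<and>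
     (\<forall>c x. norm (sm c x) = cmod c * norm x)"

definition cstar_algebra ::
  "(complex \<Rightarrow> 'a::{real_normed_algebra_1,banach} \<Rightarrow> 'a) \<Rightarrow> ('a \<Rightarrow> 'a) \<Rightarrow> bool" where
  "cstar_algebra sm star \<longleftrightarrow>
     complex_algebra_scalar sm \<and>
     (\<forall>x y. star (x + y) = star x + star y) \<and>
     (\<forall>c x. star (sm c x) = sm (cnj c) (star x)) \<and>
     (\<forall>x. star (star x) = x) \<and>
     (\<forall>x y. star (x * y) = star y * star x) \<and>
     (\<forall>x. norm (star x * x) = (norm x)\<^sup>2)"

definition closed_ideal ::
  "(complex \<Rightarrow> 'a::{real_normed_algebra_1,banach} \<Rightarrow> 'a) \<Rightarrow> 'a set \<Rightarrow> bool" where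
  "closed_ideal sm I \<longleftrightarrow>
     0 \<in> I \<and> (\<forall>x\<in>I. \<forall>y\<in>I. x + y \<in> I) \<and> (\<forall>c. \<forall>x\<in>I. sm c x \<in> I) \<and>
     (\<forall>a. \<forall>x\<in>I. a * x \<in> I \<and> x * a \<in> I) \<and> closed I"

definition simple_algebra ::
  "(complex \<Rightarrow> 'a::{real_normed_algebra_1,banach} \<Rightarrow> 'a) \<Rightarrow> bool" where
  "simple_algebra sm \<longleftrightarrow> (\<forall>I. closed_ideal sm I \<longrightarrow> I = {0} \<or> I = UNIV)"

definition complex_linear ::
  "(complex \<Rightarrow> 'a::{real_normed_algebra_1,banach} \<Rightarrow> 'a) \<Rightarrow> ('a \<Rightarrow> 'a) \<Rightarrow> bool" where
  "complex_linear sm D \<longleftrightarrow>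
     (\<forall>x y. D (x + y) = D x + D y) \<and> (\<forall>c x. D (sm c x) = sm c (D x))"

definition linear_derivation ::
  "(complex \<Rightarrow> 'a::{real_normed_algebra_1,banach} \<Rightarrow> 'a) \<Rightarrow> ('a \<Rightarrow> 'a) \<Rightarrow> bool" where
  "linear_derivation sm D \<longleftrightarrow>
     complex_linear sm D \<and> (\<forall>a b. D (a * b) = D a * b + a * D b)"

text \<open>Faithful tracial state: positive linear functional (positive elements of a
C*-algebra are exactly those of the form star y * y), tau 1 = 1, tracial, faithful.\<close>
definition faithful_tracial_state ::
  "(complex \<Rightarrow> 'a::{real_normed_algebra_1,banach} \<Rightarrow> 'a) \<Rightarrow> ('a \<Rightarrow> 'a) \<Rightarrow> ('a \<Rightarrow> complex) \<Rightarrow> bool" where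
  "faithful_tracial_state sm star tau \<longleftrightarrow>
     (\<forall>x y. tau (x + y) = tau x + tau y) \<and>
     (\<forall>c x. tau (sm c x) = c * tau x) \<and>
     (\<forall>y. Im (tau (star y * y)) = 0 \<and> Re (tau (star y * y)) \<ge> 0) \<and>
     tau 1 = 1 \<and>
     (\<forall>a b. tau (a * b) = tau (b * a)) \<and>
     (\<forall>x. tau (star x * x) = 0 \<longrightarrow> x = 0)"

end

theory Submission
  imports Defs
begin

text \<open>Every derivation \<open>D\<close> of the algebra is bounded: a derivation commuting with the involution never
  maps a self-adjoint contraction close to 1, so its separating space, a closed ideal, is 0. If \<open>u\<close>
  is unitary, then \<open>\<tau> (u\<^sup>-\<^sup>N D (u\<^sup>N)) = N \<tau> (u\<^sup>* D u)\<close> is bounded in \<open>N\<close>, hence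
  \<open>\<tau> (u\<^sup>* D u) = 0\<close>; letting \<open>u\<close> tend to 1 gives \<open>\<tau> \<circ> D = 0\<close>. Therefore \<open>\<phi>\<close> is skew for the
  nondegenerate form \<open>\<tau> (a b)\<close>, which makes it linear. Polarising
  \<open>\<tau> ((\<phi> a b + a \<phi> b) a b) = \<tau> (D (a b) a b) = 0\<close> in \<open>b\<close> shows that \<open>\<phi>\<close> is a Jordan triple
  derivation vanishing at 1, and on a prime algebra such a map is a derivation.\<close>

section \<open>Closed graph theorem and a binomial estimate\<close>

text \<open>By Baire, some closure \<open>E n\<close> contains a ball. Rescaling gives
  approximations of any \<open>x\<close> with controlled image, and a geometric series of
  corrections together with the closed graph at 0 removes the approximation error.\<close>

lemma closed_graph_bounded:
  fixes T :: "'a::banach \<Rightarrow> 'b::banach"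
  assumes lin: "linear T"
    and clg: "\<And>a c. \<lbrakk>a \<longlonglongrightarrow> 0; (\<lambda>n. T (a n)) \<longlonglongrightarrow> c\<rbrakk> \<Longrightarrow> c = 0"
  obtains K where "K \<ge> 0" "\<And>x. norm (T x) \<le> K * norm x"
proof -
  define E where "E n = closure {x. norm (T x) \<le> real n}" for n
  have "\<exists>n. interior (E n) \<noteq> {}"
  proof (rule ccontr)
    assume "\<not> ?thesis"
    then have emp: "interior (E n) = {}" for n by auto
    have "euclidean interior_of \<Union>(range E) = {}"
    proof (rule Baire_category_alt)
      show "completely_metrizable_space (euclidean::'a topology) \<or> 
        locally_compact_space (euclidean::'a topology) \<and> regular_space (euclidean::'a topology)"
        using completely_metrizable_space_euclidean by blast
      show "closedin euclidean S \<and> euclidean interior_of S = {}" if "S \<in> range E" for S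
        using that emp by (auto simp: E_def)
    qed auto
    moreover have "\<Union>(range E) = UNIV"
    proof -
      have "\<exists>n. x \<in> E n" for x
      proof -
        obtain n where "norm (T x) \<le> real n" using real_arch_simple by blast
        then show ?thesis unfolding E_def using closure_subset by fastforce
      qed
      then show ?thesis by blast
    qed
    ultimately show False by auto
  qed
  then obtain n x0 where "x0 \<in> interior (E n)" by blast
  then obtain r where r: "r > 0" "cball x0 r \<subseteq> E n"
    by (meson mem_interior_cball)
  define K where "K = 2 * real n / r"
  have K0: "K \<ge> 0" using r by (simp add: K_def)
  \<comment> \<open>Rescaled to length \<open>r\<close>, \<open>x\<close> is the difference of two
    points of the ball. Both are approximated by points whose images have norm at most
    \<open>n\<close>, which explains \<open>K = 2 * n / r\<close>.\<close>
  have approx: "\<exists>y. norm (x - y) < e \<and> norm (T y) \<le> K * norm x" if "e > 0" for x e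
  proof (cases "x = 0")
    case True
    then show ?thesis using that linear_0[OF lin] by (intro exI[of _ 0]) auto
  next
    case False
    \<comment> \<open>Scaling back by \<open>norm x / r\<close> turns an error \<open>d\<close> into
      \<open>e\<close>.\<close>
    define d where "d = e * r / norm x"
    have d: "d > 0" using False r that by (simp add: d_def)
    have "x0 \<in> E n" "x0 + (r / norm x) *\<^sub>R x \<in> E n"
      using r False by (auto simp: subset_iff dist_norm)
    then obtain u v where u: "norm (T u) \<le> real n" "dist u x0 < d / 2"
      and v: "norm (T v) \<le> real n" "dist v (x0 + (r / norm x) *\<^sub>R x) < d / 2"
      unfolding E_def closure_approachable using d half_gt_zero[OF d] by blast
    define y where "y = (norm x / r) *\<^sub>R (v - u)"
    have "norm ((r / norm x) *\<^sub>R x - (v - u)) 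
        = norm ((u - x0) - (v - (x0 + (r / norm x) *\<^sub>R x)))"
      by (simp add: algebra_simps)
    also have "\<dots> \<le> norm (u - x0) + norm (v - (x0 + (r / norm x) *\<^sub>R x))"
      by (rule norm_triangle_ineq4)
    also have "\<dots> < d" using u(2) v(2) by (simp add: dist_norm)
    finally have *: "norm ((r / norm x) *\<^sub>R x - (v - u)) < d" .
    have "x - y = (norm x / r) *\<^sub>R ((r / norm x) *\<^sub>R x - (v - u))"
      using False r by (simp add: y_def algebra_simps)
    then have "norm (x - y) = norm x / r * norm ((r / norm x) *\<^sub>R x - (v - u))"
      using r by simp
    also have "\<dots> < norm x / r * d"
      using * False r by (intro mult_strict_left_mono) auto
    also have "\<dots> = e" using False r by (simp add: d_def)
    finally have 1: "norm (x - y) < e" .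
    have "norm (T v - T u) \<le> 2 * real n"
      using norm_triangle_ineq4[of "T v" "T u"] u(1) v(1) by linarith
    then have "norm x / r * norm (T v - T u) \<le> norm x / r * (2 * real n)"
      using r by (intro mult_left_mono) auto
    moreover have "norm (T y) = norm x / r * norm (T v - T u)"
      using r by (simp add: y_def linear_scale[OF lin] linear_diff[OF lin])
    ultimately have 2: "norm (T y) \<le> K * norm x" by (simp add: K_def mult.commute)
    show ?thesis using 1 2 by blast
  qed
  have bound: "norm (T x) \<le> 2 * K" if x: "norm x \<le> 1" for x
  proof -
    define f where "f x e = (SOME y. norm (x - y) < e \<and> norm (T y) \<le> K * norm x)" for x e
    have f: "norm (x - f x e) < e \<and> norm (T (f x e)) \<le> K * norm x" if "e > 0" for x e
      unfolding f_def by (rule someI_ex[OF approx[OF that]])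
    \<comment> \<open>\<open>R k\<close> is what remains of \<open>x\<close> after \<open>k\<close>
      corrections; the tolerances halve, so the images of the corrections are summable with total at
      most \<open>2 * K\<close>.\<close>
    define R where "R = rec_nat x (\<lambda>k z. z - f z ((1/2) ^ Suc k))"
    have R0: "R 0 = x" and RS: "R (Suc k) = R k - f (R k) ((1/2) ^ Suc k)" for k
      by (simp_all add: R_def)
    have nR: "norm (R k) \<le> (1/2) ^ k" for k
    proof (cases k)
      case 0 then show ?thesis using x R0 by simp
    next
      case (Suc j)
      have "norm (R j - f (R j) ((1/2) ^ Suc j)) < (1/2) ^ Suc j"
        using f[of "(1/2) ^ Suc j" "R j"] by simp
      then show ?thesis using RS[of j] Suc by simp
    qed
    define g where "g k = T (R k - R (Suc k))" for k
    have ng: "norm (g k) \<le> K * (1/2) ^ k" for k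
    proof -
      have "norm (g k) \<le> K * norm (R k)"
        using f[of "(1/2) ^ Suc k" "R k"] RS[of k] by (simp add: g_def)
      also have "\<dots> \<le> K * (1/2) ^ k" using nR K0 by (intro mult_left_mono) auto
      finally show ?thesis .
    qed
    have sK: "(\<lambda>k. K * (1/2) ^ k) sums (K * 2)"
      using geometric_sums[of "1/2::real"] by (intro sums_mult) auto
    have sg: "summable g"
      by (rule summable_comparison_test'[OF sums_summable[OF sK], of 0]) (rule ng)
    have "(\<lambda>n. sum g {..<n}) = (\<lambda>n. T x - T (R n))"
    proof
      fix n show "sum g {..<n} = T x - T (R n)"
        by (induction n) (simp_all add: R0 g_def linear_diff[OF lin])
    qed
    then have "(\<lambda>n. T x - T (R n)) \<longlonglongrightarrow> suminf g"
      using summable_LIMSEQ[OF sg] by simp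
    \<comment> \<open>The images of the remainders converge while \<open>R\<close> tends to 0, so
      the hypothesis \<open>clg\<close> forces their limit to vanish, that is
      \<open>T x = suminf g\<close>.\<close>
    then have "(\<lambda>n. T x - (T x - T (R n))) \<longlonglongrightarrow> T x - suminf g"
      by (intro tendsto_intros)
    then have "(\<lambda>n. T (R n)) \<longlonglongrightarrow> T x - suminf g" by simp
    moreover have "R \<longlonglongrightarrow> 0"
    proof (rule tendsto_norm_zero_cancel, rule tendsto_sandwich[OF _ _ tendsto_const])
      show "(\<lambda>k. (1/2::real) ^ k) \<longlonglongrightarrow> 0" by (intro LIMSEQ_power_zero) auto
      show "\<forall>\<^sub>F n in sequentially. norm (R n) \<le> (1/2) ^ n" using nR by auto
    qed auto
    ultimately have "T x - suminf g = 0" using clg by blast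
    moreover have "norm (suminf g) \<le> K * 2"
      using norm_suminf_le[OF ng sums_summable[OF sK]] sums_unique[OF sK] by simp
    ultimately show ?thesis by simp
  qed
  show ?thesis
  proof
    show "2 * K \<ge> 0" using K0 by simp
    fix x show "norm (T x) \<le> 2 * K * norm x"
    proof (cases "x = 0")
      case True then show ?thesis using linear_0[OF lin] by simp
    next
      case False
      have "norm (T ((1 / norm x) *\<^sub>R x)) \<le> 2 * K" using False by (intro bound) auto
      then show ?thesis using False by (simp add: linear_scale[OF lin] field_simps)
    qed
  qed
qed

section \<open>Binomial estimates for powers of \<open>1 + x\<close>\<close>

lemma one_plus_power_binomial:
  fixes x :: "'a::real_algebra_1"
  shows "(1 + x) ^ n = (\<Sum>k\<le>n. real (n choose k) *\<^sub>R x ^ k)"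
proof (induction n)
  case (Suc n)
  have "(1 + x) ^ Suc n = (\<Sum>k\<le>n. real (n choose k) *\<^sub>R x ^ k) + (\<Sum>k\<le>n. real (n choose k) *\<^sub>R x ^ Suc k)"
    by (simp add: Suc distrib_right sum_distrib_left scaleR_add_right sum.distrib)
  also have "(\<Sum>k\<le>n. real (n choose k) *\<^sub>R x ^ k) = (\<Sum>k\<le>Suc n. real (n choose k) *\<^sub>R x ^ k)"
    by simp
  also have "\<dots> = 1 + (\<Sum>k\<le>n. real (n choose Suc k) *\<^sub>R x ^ Suc k)"
    by (subst sum.atMost_Suc_shift) simp
  finally show ?case
    by (subst sum.atMost_Suc_shift) (simp add: sum.distrib scaleR_add_left add.assoc add.commute)
qed simp

text \<open>After expansion the coefficients are differences of neighbouring entries in a row of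
  Pascal's triangle. Their absolute values add up to the total variation of the row, which by
  unimodality is twice the central entry.\<close>

lemma norm_one_minus_times_power_le:
  fixes x :: "'a::real_normed_algebra_1"
  assumes "norm x \<le> 1"
  shows "norm ((1 - x) * (1 + x) ^ (2 * m)) \<le> 2 * real ((2 * m) choose m)"
proof -
  define b where "b k = real ((2 * m) choose k)" for k
  define S where "S n = (\<Sum>k\<le>n. b k *\<^sub>R (x ^ k - x ^ Suc k))" for n
  have nx: "norm (x ^ k) \<le> 1" for k
    using norm_power_ineq[of x k] assms by (meson norm_ge_zero order_trans power_le_one)
  \<comment> \<open>The added term cancels the negative top term of the partial sum, so that each
    step contributes exactly one difference of coefficients.\<close>
  have step: "norm (S (Suc n) + b (Suc n) *\<^sub>R x ^ Suc (Suc n)) 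
      \<le> norm (S n + b n *\<^sub>R x ^ Suc n) + \<bar>b (Suc n) - b n\<bar>" for n
  proof -
    have "S (Suc n) + b (Suc n) *\<^sub>R x ^ Suc (Suc n) 
      = (S n + b n *\<^sub>R x ^ Suc n) + (b (Suc n) - b n) *\<^sub>R x ^ Suc n"
      by (simp add: S_def algebra_simps)
    then have "norm (S (Suc n) + b (Suc n) *\<^sub>R x ^ Suc (Suc n)) 
      \<le> norm (S n + b n *\<^sub>R x ^ Suc n) + \<bar>b (Suc n) - b n\<bar> * norm (x ^ Suc n)"
      by (metis norm_scaleR norm_triangle_ineq)
    also have "\<bar>b (Suc n) - b n\<bar> * norm (x ^ Suc n) \<le> \<bar>b (Suc n) - b n\<bar> * 1"
      by (intro mult_left_mono nx) auto
    finally show ?thesis by simp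
  qed
  \<comment> \<open>On the rising half the variation telescopes to \<open>b n\<close>; on the
    falling half, in \<open>high\<close>, it continues to
    \<open>2 * b m - b (m + j)\<close>.\<close>
  have low: "norm (S n + b n *\<^sub>R x ^ Suc n) \<le> b n" if "n \<le> m" for n
    using that
  proof (induction n)
    case 0 then show ?case by (simp add: S_def b_def)
  next
    case (Suc n)
    have "b n \<le> b (Suc n)" unfolding b_def using Suc.prems by (intro of_nat_mono binomial_mono) auto
    with step[of n] Suc show ?case by simp
  qed
  have high: "m + j \<le> 2 * m \<Longrightarrow> norm (S (m + j) + b (m + j) *\<^sub>R x ^ Suc (m + j)) \<le> 2 * b m - b (m + j)" for j
  proof (induction j)
    case 0 then show ?case using low[of m] by simp
  next
    case (Suc j)
    have "b (Suc (m + j)) \<le> b (m + j)" 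
      unfolding b_def using Suc.prems by (intro of_nat_mono binomial_antimono) auto
    with step[of "m + j"] Suc show ?case by simp
  qed
  have eq: "(1 - x) * (1 + x) ^ (2 * m) = S (2 * m)"
    by (simp add: one_plus_power_binomial S_def b_def left_diff_distrib sum_distrib_left 
        scaleR_diff_right sum_subtractf)
  have "norm (S (2 * m)) \<le> norm (S (2 * m) + b (2 * m) *\<^sub>R x ^ Suc (2 * m)) + norm (b (2 * m) *\<^sub>R x ^ Suc (2 * m))"
    using norm_triangle_ineq4[of "S (2 * m) + b (2 * m) *\<^sub>R x ^ Suc (2 * m)" "b (2 * m) *\<^sub>R x ^ Suc (2 * m)"] 
    by (simp del: power_Suc)
  also have "\<dots> \<le> (2 * b m - b (2 * m)) + b (2 * m) * 1"
  proof (intro add_mono)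
    show "norm (S (2 * m) + b (2 * m) *\<^sub>R x ^ Suc (2 * m)) \<le> 2 * b m - b (2 * m)"
      using high[of m] by (simp only: mult_2 order_refl)
    have "b (2 * m) \<ge> 0" by (simp only: b_def of_nat_0_le_iff)
    then show "norm (b (2 * m) *\<^sub>R x ^ Suc (2 * m)) \<le> b (2 * m) * 1"
      unfolding norm_scaleR using nx[of "Suc (2 * m)"] by (metis abs_of_nonneg mult_left_mono)
  qed
  finally show ?thesis unfolding eq by (simp add: b_def)
qed

text \<open>Consecutive terms have ratio \<open>(2 * m + 1) / (2 * m + 2)\<close>, from which
  induction bounds the square of the term by \<open>1 / (2 * m + 1)\<close>.\<close>

lemma central_binomial_ratio_tendsto_0: "(\<lambda>m. real ((2 * m) choose m) / 4 ^ m) \<longlonglongrightarrow> 0"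
proof -
  define a where "a m = real ((2 * m) choose m) / 4 ^ m" for m
  have rec: "a (Suc m) = a m * (2 * real m + 1) / (2 * real m + 2)" for m
  proof -
    have "Suc m * ((2 * Suc m) choose Suc m) = 2 * (Suc (2 * m) * ((2 * m) choose m))"
    proof -
      have "Suc (2 * m) choose m = Suc (2 * m) choose Suc m"
        using binomial_symmetric[of m "Suc (2 * m)"] by (simp del: binomial_Suc_Suc add: Suc_diff_le)
      then have "(2 * Suc m) choose Suc m = 2 * (Suc (2 * m) choose Suc m)"
        using binomial_Suc_Suc[of "Suc (2 * m)" m] by (simp del: binomial_Suc_Suc)
      then show ?thesis using Suc_times_binomial[of m "2 * m"] by (simp del: binomial_Suc_Suc)
    qed
    then have "real (Suc m) * real ((2 * Suc m) choose Suc m) = 2 * (real (Suc (2 * m)) * real ((2 * m) choose m))"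
      by (metis of_nat_mult of_nat_numeral)
    then have eqr: "(real m + 1) * real ((2 * Suc m) choose Suc m) = 2 * ((2 * real m + 1) * real ((2 * m) choose m))"
      by (simp only: of_nat_Suc of_nat_mult of_nat_numeral add.commute)
    have aux: "A / (4 * q) = B / q * (2 * r + 1) / (2 * r + 2)"
      if "(r + 1) * A = 2 * ((2 * r + 1) * B)" "q > 0" "r \<ge> 0" for A B q r :: real
    proof -
      have "A * (2 * r + 2) * q = B * (2 * r + 1) * (4 * q)" using that(1) by algebra
      then show ?thesis using that(2,3) by (simp add: frac_eq_eq mult.assoc)
    qed
    show ?thesis unfolding a_def power_Suc by (rule aux[OF eqr]) auto
  qed
  have pos: "a m \<ge> 0" for m by (simp add: a_def)
  have sq: "(a m)\<^sup>2 \<le> 1 / (2 * real m + 1)" for m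
  proof (induction m)
    case 0 then show ?case by (simp add: a_def)
  next
    case (Suc m)
    have "(a (Suc m))\<^sup>2 = (a m)\<^sup>2 * ((2 * real m + 1) / (2 * real m + 2))\<^sup>2"
      by (simp add: rec power_mult_distrib power_divide)
    also have "\<dots> \<le> 1 / (2 * real m + 1) * ((2 * real m + 1) / (2 * real m + 2))\<^sup>2"
      using Suc by (intro mult_right_mono) auto
    also have "\<dots> = (2 * real m + 1) / (2 * real m + 2)\<^sup>2"
      by (simp add: power2_eq_square)
    \<comment> \<open>This is
      \<open>(2 * m + 1) * (2 * m + 3) \<le> (2 * m + 2)\<^sup>2\<close>.\<close>
    also have "\<dots> \<le> 1 / (2 * real (Suc m) + 1)"
      by (simp add: divide_simps power2_eq_square) (simp add: algebra_simps)
    finally show ?case .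
  qed
  have "(\<lambda>m. (a m)\<^sup>2) \<longlonglongrightarrow> 0"
  proof (rule tendsto_sandwich[OF _ _ tendsto_const])
    show "\<forall>\<^sub>F m in sequentially. (a m)\<^sup>2 \<le> 1 / real (Suc m)"
    proof (intro always_eventually allI)
      fix m show "(a m)\<^sup>2 \<le> 1 / real (Suc m)"
        by (rule order_trans[OF sq]) (auto simp: divide_simps)
    qed
    show "(\<lambda>m. 1 / real (Suc m)) \<longlonglongrightarrow> 0" using LIMSEQ_inverse_real_of_nat by (simp add: inverse_eq_divide)
  qed auto
  then have "(\<lambda>m. sqrt ((a m)\<^sup>2)) \<longlonglongrightarrow> sqrt 0" by (rule tendsto_real_sqrt)
  then show ?thesis using pos by (simp add: a_def)
qed

section \<open>Square roots and derivations in C*-algebras\<close>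

locale cstar =
  fixes sm :: "complex \<Rightarrow> 'a::{real_normed_algebra_1,banach} \<Rightarrow> 'a" and star :: "'a \<Rightarrow> 'a"
  assumes cstar: "cstar_algebra sm star"
begin

section \<open>Scalars, involution and norm\<close>

lemma sm_of_real: "sm (complex_of_real r) x = r *\<^sub>R x"
  and sm_add_left: "sm (c + d) x = sm c x + sm d x"
  and sm_add_right: "sm c (x + y) = sm c x + sm c y"
  and sm_sm: "sm c (sm d x) = sm (c * d) x"
  and sm_mult_left: "sm c x * y = sm c (x * y)"
  and norm_sm: "norm (sm c x) = cmod c * norm x"
  and star_add: "star (x + y) = star x + star y"
  and star_sm: "star (sm c x) = sm (cnj c) (star x)"
  and star_star [simp]: "star (star x) = x"
  and star_mult: "star (x * y) = star y * star x"
  and norm_star_mult: "norm (star x * x) = (norm x)\<^sup>2"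
  using cstar unfolding cstar_algebra_def complex_algebra_scalar_def by simp_all

lemma sm_mult_right: "x * sm c y = sm c (x * y)"
  using cstar unfolding cstar_algebra_def complex_algebra_scalar_def by metis

lemma sm_1 [simp]: "sm 1 x = x"
  using sm_of_real[of 1 x] by simp

lemma sm_minus_1: "sm (-1) x = - x"
  using sm_of_real[of "-1" x] by simp

lemma sm_minus_left: "sm (- c) x = - sm c x"
  using sm_sm[of "-1" c x] by (simp add: sm_minus_1)

lemma sm_scaleR: "sm c (r *\<^sub>R x) = r *\<^sub>R sm c x"
  by (metis mult.commute sm_of_real sm_sm)

lemma bounded_linear_sm: "bounded_linear (sm c)"
  by (rule bounded_linear_intro[where K="cmod c"])
    (simp_all add: sm_add_right sm_scaleR norm_sm mult.commute)

lemmas sm_diff_right = linear_diff[OF bounded_linear.linear[OF bounded_linear_sm]]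

lemma star_scaleR: "star (r *\<^sub>R x) = r *\<^sub>R star x"
  by (metis complex_cnj_complex_of_real sm_of_real star_sm)

lemma norm_star [simp]: "norm (star x) = norm x"
proof -
  have *: "norm x \<le> norm (star x)" for x
  proof (cases "x = 0")
    case False
    have "norm x * norm x \<le> norm (star x) * norm x"
      using norm_mult_ineq[of "star x" x] by (simp add: norm_star_mult power2_eq_square)
    then show ?thesis using False by simp
  qed simp
  show ?thesis using *[of x] *[of "star x"] by simp
qed

lemma bounded_linear_star: "bounded_linear star"
  by (rule bounded_linear_intro[where K=1]) (simp_all add: star_add star_scaleR)

lemma star_1 [simp]: "star 1 = 1"
  by (metis mult.right_neutral star_mult star_star)

lemmas star_diff = linear_diff[OF bounded_linear.linear[OF bounded_linear_star]]
lemmas star_0 = linear_0[OF bounded_linear.linear[OF bounded_linear_star]]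
lemmas star_neg = linear_neg[OF bounded_linear.linear[OF bounded_linear_star]]

lemma star_power: "star (x ^ n) = star x ^ n"
  by (induction n) (simp_all add: star_mult power_commutes)

text \<open>Each doubling of the exponent is one use of the C*-identity, hence the powers of
  two.\<close>

lemma norm_selfadjoint_power:
  assumes "star x = x"
  shows "norm (x ^ (2 ^ k)) = norm x ^ (2 ^ k)"
proof (induction k)
  case (Suc k)
  have "norm (x ^ (2 ^ Suc k)) = norm (star (x ^ (2 ^ k)) * x ^ (2 ^ k))"
    by (simp add: star_power assms mult_2 power_add)
  then show ?case unfolding norm_star_mult Suc by (simp only: power_Suc2 power_mult)
qed simp

lemma norm_unitary: "star u * u = 1 \<Longrightarrow> norm u = 1"
  using norm_star_mult[of u] norm_ge_zero[of u] by (simp add: power2_eq_1_iff)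

text \<open>The iteration \<open>y \<mapsto> (x + y\<^sup>2) / 2\<close> is dominated by the scalar iteration
  \<open>s \<mapsto> (1 + s\<^sup>2) / 2\<close>, which increases to 1; hence it converges up to and including the
  boundary case of norm 1, where \<open>1 - x\<close> need not be invertible.\<close>

lemma sqrt_one_minus:
  assumes sx: "star x = x" and nx: "norm x \<le> 1"
  obtains y where "star y = y" "(1 - y) * (1 - y) = 1 - x" "norm y \<le> norm x"
    "\<And>z. z * x = x * z \<Longrightarrow> z * y = y * z"
proof -
  define Y where "Y = rec_nat 0 (\<lambda>_ y. (1/2) *\<^sub>R (x + y * y))"
  define s where "s = rec_nat (0::real) (\<lambda>_ t. (1/2) * (1 + t * t))"
  have Y0: "Y 0 = 0" and YS: "Y (Suc n) = (1/2) *\<^sub>R (x + Y n * Y n)" for n by (simp_all add: Y_def)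
  have s0: "s 0 = 0" and sS: "s (Suc n) = (1/2) * (1 + s n * s n)" for n by (simp_all add: s_def)
  have sb: "0 \<le> s n \<and> s n \<le> 1" for n
    by (induction n) (auto simp: s0 sS mult_le_one)
  have Yb: "norm (Y n) \<le> s n" for n
  proof (induction n)
    case (Suc n)
    have "norm (Y (Suc n)) \<le> (1/2) * (norm x + norm (Y n * Y n))"
      unfolding YS norm_scaleR using norm_triangle_ineq by simp
    also have "norm (Y n * Y n) \<le> s n * s n"
      using norm_mult_ineq[of "Y n" "Y n"] mult_mono[OF Suc Suc] sb by (meson norm_ge_zero order_trans)
    finally show ?case using nx by (simp add: sS)
  qed (simp add: Y0 s0)
  have Yd: "norm (Y (Suc n) - Y n) \<le> s (Suc n) - s n" for n
  proof (induction n)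
    case 0 then show ?case using nx by (simp add: Y0 YS s0 sS)
  next
    case (Suc n)
    have "Y (Suc (Suc n)) - Y (Suc n) 
        = (1/2) *\<^sub>R (Y (Suc n) * (Y (Suc n) - Y n) + (Y (Suc n) - Y n) * Y n)"
      unfolding YS[of "Suc n"] by (subst (3) YS) (simp add: algebra_simps)
    then have "norm (Y (Suc (Suc n)) - Y (Suc n)) \<le>
        (1/2) * (norm (Y (Suc n) * (Y (Suc n) - Y n)) + norm ((Y (Suc n) - Y n) * Y n))"
      using norm_triangle_ineq by simp
    also have "norm (Y (Suc n) * (Y (Suc n) - Y n)) \<le> s (Suc n) * (s (Suc n) - s n)"
      using norm_mult_ineq mult_mono[OF Yb[of "Suc n"] Suc] sb[of "Suc n"] by (meson norm_ge_zero order_trans)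
    also have "norm ((Y (Suc n) - Y n) * Y n) \<le> (s (Suc n) - s n) * s n"
      using norm_mult_ineq mult_mono[OF Suc Yb[of n]] order_trans[OF norm_ge_zero Suc]
      by (meson norm_ge_zero order_trans)
    also have "(1/2) * (s (Suc n) * (s (Suc n) - s n) + (s (Suc n) - s n) * s n) = s (Suc (Suc n)) - s (Suc n)"
    proof -
      have "s (Suc n) * (s (Suc n) - s n) + (s (Suc n) - s n) * s n = s (Suc n) * s (Suc n) - s n * s n"
        by (simp add: algebra_simps)
      then show ?thesis using sS[of "Suc n"] sS[of n] by argo
    qed
    finally show ?case by simp
  qed
  \<comment> \<open>The increments of the bounded increasing sequence \<open>s\<close> are summable
    and dominate those of \<open>Y\<close>.\<close>
  have "incseq s" using order_trans[OF norm_ge_zero Yd] by (intro incseq_SucI) simp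
  then obtain L where "s \<longlonglongrightarrow> L" using incseq_convergent[of s 1] sb by blast
  then have "summable (\<lambda>n. s (Suc n) - s n)" by (rule telescope_summable)
  then have "summable (\<lambda>n. Y (Suc n) - Y n)"
    by (rule summable_comparison_test'[of _ 0]) (rule Yd)
  from summable_LIMSEQ[OF this] obtain y where Yl: "Y \<longlonglongrightarrow> y"
    by (auto simp: sum_lessThan_telescope Y0)
  have "(\<lambda>n. (1/2) *\<^sub>R (x + Y n * Y n)) \<longlonglongrightarrow> (1/2) *\<^sub>R (x + y * y)"
    by (intro tendsto_intros Yl)
  then have "(\<lambda>n. Y (Suc n)) \<longlonglongrightarrow> (1/2) *\<^sub>R (x + y * y)" by (simp add: YS)
  with LIMSEQ_Suc[OF Yl] have fp: "y = (1/2) *\<^sub>R (x + y * y)" by (rule LIMSEQ_unique)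
  have sY: "star (Y n) = Y n" for n
    by (induction n) (simp_all add: Y0 YS star_0 star_add star_scaleR star_mult sx)
  have "star y = y"
    using LIMSEQ_unique[OF bounded_linear.tendsto[OF bounded_linear_star Yl]] Yl by (simp add: sY)
  moreover have "(1 - y) * (1 - y) = 1 - x"
  proof -
    have "2 *\<^sub>R y = x + y * y" by (subst fp) simp
    then show ?thesis by (simp add: algebra_simps scaleR_2)
  qed
  \<comment> \<open>In the fixed point equation \<open>norm (y * y)\<close> is at most
    \<open>norm y\<close>, because \<open>norm y \<le> 1\<close>; half of \<open>norm y\<close> is
    then absorbed on the left.\<close>
  moreover have "norm y \<le> norm x"
  proof -
    have ny: "norm y \<le> 1"
      by (rule LIMSEQ_le_const2[OF tendsto_norm[OF Yl]]) (meson Yb sb order_trans)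
    have "norm y \<le> (1/2) * (norm x + norm (y * y))"
      by (subst fp) (use norm_triangle_ineq in simp)
    moreover have "norm (y * y) \<le> norm y"
      using norm_mult_ineq[of y y] mult_left_le[OF ny norm_ge_zero[of y]] by linarith
    ultimately show ?thesis by argo
  qed
  moreover have "z * y = y * z" if z: "z * x = x * z" for z
  proof -
    have "z * Y n = Y n * z" for n
    proof (induction n)
      case (Suc n)
      have "z * (Y n * Y n) = (Y n * Y n) * z" by (metis Suc mult.assoc)
      then show ?case by (simp add: YS z distrib_left distrib_right)
    qed (simp add: Y0)
    then have "(\<lambda>n. z * Y n) \<longlonglongrightarrow> y * z" using tendsto_mult_right[OF Yl] by simp
    with tendsto_mult_left[OF Yl] show ?thesis by (rule LIMSEQ_unique)
  qed
  ultimately show thesis by (rule that)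
qed

text \<open>\<open>s\<close> and \<open>t\<close> act as cosine and sine; commutation cancels the
  mixed terms.\<close>

lemma unitary_of_commuting:
  assumes "star s = s" "star t = t" "s * t = t * s" "s * s + t * t = 1"
  shows "star (s + sm \<i> t) = s - sm \<i> t" "star (s + sm \<i> t) * (s + sm \<i> t) = 1"
    "(s + sm \<i> t) * star (s + sm \<i> t) = 1"
proof -
  show 1: "star (s + sm \<i> t) = s - sm \<i> t"
    using assms by (simp add: star_add star_sm sm_minus_left)
  show "star (s + sm \<i> t) * (s + sm \<i> t) = 1" "(s + sm \<i> t) * star (s + sm \<i> t) = 1"
    unfolding 1 using assms
    by (simp_all add: ring_distribs sm_mult_left sm_mult_right sm_sm sm_minus_1 sm_add_right sm_diff_right)
qed

text \<open>With \<open>v\<^sup>2 = 1 - w\<^sup>2\<close>, the element is the real part of the square of the unitary \<open>w + \<i> v\<close>.\<close>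

lemma norm_two_square_minus_one_le:
  assumes w: "star w = w" and g: "norm (w * w) \<le> 1"
  shows "norm (2 *\<^sub>R (w * w) - 1) \<le> 1"
proof -
  have "star (w * w) = w * w" by (simp add: star_mult w)
  then obtain y where y: "star y = y" "(1 - y) * (1 - y) = 1 - w * w" 
      "\<And>z. z * (w * w) = (w * w) * z \<Longrightarrow> z * y = y * z"
    using sqrt_one_minus g by metis
  define v where "v = 1 - y"
  have v: "star v = v" "v * v = 1 - w * w" using y by (simp_all add: v_def star_diff)
  have wv: "w * v = v * w" using y(3)[of w] by (simp add: v_def algebra_simps)
  define u where "u = w + sm \<i> v"
  have u: "star u = w - sm \<i> v" "norm u = 1"
    unfolding u_def using v wv w by (auto intro!: norm_unitary unitary_of_commuting)
  have "2 *\<^sub>R (2 *\<^sub>R (w * w) - 1) = u * u + star u * star u"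
    unfolding u(1) unfolding u_def
    by (simp add: ring_distribs sm_mult_left sm_mult_right sm_sm sm_minus_1 sm_add_right sm_diff_right v scaleR_2)
  then have "2 * norm (2 *\<^sub>R (w * w) - 1) = norm (u * u + star u * star u)"
    by (metis abs_numeral norm_scaleR)
  also have "\<dots> \<le> norm u * norm u + norm (star u) * norm (star u)"
    by (meson add_mono norm_mult_ineq norm_triangle_ineq order_trans)
  finally show ?thesis using u(2) by simp
qed

text \<open>For \<open>x = 2 *\<^sub>R g - 1\<close>, a contraction,
  \<open>(1 - x) * (1 + x) ^ (2 * m)\<close> is \<open>(1 - g) * g ^ (2 * m)\<close> times
  \<open>2 * 4 ^ m\<close>. The binomial estimate makes the latter small, so high powers of
  \<open>g\<close> are approximate eigenvectors for the eigenvalue 1.\<close>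

lemma approximate_eigenvector:
  assumes w: "star w = w" and g: "g = w * w" "norm g = 1" and "e > 0"
  shows "\<exists>n. norm (g ^ n) = 1 \<and> norm (g ^ n * g ^ n) = 1 \<and> norm ((1 - g) * g ^ n) < e"
proof -
  obtain N where N: "\<And>m. m \<ge> N \<Longrightarrow> real ((2 * m) choose m) / 4 ^ m < e"
    using LIMSEQ_D[OF central_binomial_ratio_tendsto_0 \<open>e > 0\<close>] by auto
  \<comment> \<open>A power of two at least \<open>N\<close>, so that the norm of
    \<open>g ^ (2 * m)\<close> is known exactly.\<close>
  define m :: nat where "m = 2 ^ N"
  have "N \<le> m" by (simp add: m_def less_imp_le)
  have sg: "star g = g" by (simp add: g star_mult w)
  have 1: "norm (g ^ (2 * m)) = 1"
    using norm_selfadjoint_power[OF sg, of "Suc N"] by (simp add: m_def g(2))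
  have 2: "norm (g ^ (2 * m) * g ^ (2 * m)) = 1"
    using norm_star_mult[of "g ^ (2 * m)"] by (simp add: 1 star_power sg)
  define x where "x = 2 *\<^sub>R g - 1"
  have "norm x \<le> 1" unfolding x_def using norm_two_square_minus_one_le w g by simp
  from norm_one_minus_times_power_le[OF this, of m]
  have "norm ((1 - x) * (1 + x) ^ (2 * m)) \<le> 2 * real ((2 * m) choose m)" .
  also have "(1 - x) * (1 + x) ^ (2 * m) = (2 * 4 ^ m) *\<^sub>R ((1 - g) * g ^ (2 * m))"
  proof -
    have "1 - x = 2 *\<^sub>R (1 - g)" "1 + x = 2 *\<^sub>R g"
      by (simp_all add: x_def scaleR_2 algebra_simps)
    moreover have "(2::real) ^ (2 * m) = 4 ^ m" by (simp add: power_mult)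
    ultimately show ?thesis by (simp add: scaleR_power)
  qed
  finally have "norm ((1 - g) * g ^ (2 * m)) \<le> real ((2 * m) choose m) / 4 ^ m"
    unfolding norm_scaleR by (simp add: pos_le_divide_eq mult.commute)
  with N[OF \<open>N \<le> m\<close>] 1 2 show ?thesis by (intro exI[of _ "2 * m"]) auto
qed

text \<open>Normalise \<open>1 + a\<close> to \<open>g\<close> of norm 1 and write \<open>1 - g = y\<^sup>2\<close>. A power \<open>z\<close> of \<open>g\<close> with
  \<open>y z\<close> almost 0 almost annihilates \<open>D (y\<^sup>2) = D y y + y D y\<close> from both sides, and \<open>D a\<close> is a multiple of
  \<open>D (y\<^sup>2)\<close>.\<close>

lemma derivation_not_close_to_one:
  assumes lin: "linear D" and der: "\<And>a b. D (a * b) = D a * b + a * D b"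
    and a: "star a = a" "norm a \<le> 1"
  shows "norm (1 - D a) \<ge> 1"
proof -
  have D1: "D 1 = 0" using der[of 1 1] by simp
  have "star (- a) = - a" "norm (- a) \<le> 1" using a by (simp_all add: star_neg)
  \<comment> \<open>The square root is taken for \<open>- a\<close>, making \<open>1 + a\<close> a
    square as \<open>approximate_eigenvector\<close> requires.\<close>
  then obtain y0 where y0: "star y0 = y0" "(1 - y0) * (1 - y0) = 1 + a"
    using sqrt_one_minus[of "-a"] by (metis diff_minus_eq_add)
  define r where "r = norm (1 + a)"
  show ?thesis
  proof (cases "r = 0")
    case True
    then have "a = - 1" by (simp add: r_def add_eq_0_iff)
    then show ?thesis by (simp add: linear_neg[OF lin] D1)
  next
    case False
    then have r: "r > 0" by (simp add: r_def)
    define w where "w = (1 / sqrt r) *\<^sub>R (1 - y0)"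
    define g where "g = (1 / r) *\<^sub>R (1 + a)"
    have w: "star w = w" by (simp add: w_def star_scaleR star_diff y0)
    have gw: "g = w * w" using r y0 by (simp add: g_def w_def)
    have ng: "norm g = 1" using r by (simp add: g_def flip: r_def)
    have sg: "star g = g" by (simp add: g_def star_scaleR star_add a)
    obtain y1 where y1: "star y1 = y1" "(1 - y1) * (1 - y1) = 1 - g"
      using sqrt_one_minus[OF sg] ng by (metis order_refl)
    define y where "y = 1 - y1"
    have y: "star y = y" "y * y = 1 - g" using y1 by (simp_all add: y_def star_diff)
    have "D (y * y) = - ((1 / r) *\<^sub>R D a)"
      by (simp add: y g_def linear_diff[OF lin] linear_add[OF lin] linear_scale[OF lin] D1)
    then have Da: "D a = - r *\<^sub>R (D y * y + y * D y)" using der[of y y] r by simp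
    have key: "1 \<le> norm (1 - D a) + 2 * r * norm (D y) * sqrt e" if "e > 0" for e
    proof -
      obtain n where n: "norm (g ^ n) = 1" "norm (g ^ n * g ^ n) = 1" "norm ((1 - g) * g ^ n) < e"
        using approximate_eigenvector[OF w gw ng \<open>e > 0\<close>] by blast
      define z where "z = g ^ n"
      have sz: "star z = z" by (simp add: z_def star_power sg)
      have nz: "norm z = 1" "norm (z * z) = 1" using n by (simp_all add: z_def)
      \<comment> \<open>The C*-identity turns smallness of \<open>y * y * z\<close> into smallness
        of \<open>y * z\<close>, at the price of a square root.\<close>
      have "(norm (y * z))\<^sup>2 = norm (z * ((1 - g) * z))"
        using norm_star_mult[of "y * z"] by (simp add: star_mult sz y(1) mult.assoc flip: y(2))
      also have "\<dots> \<le> norm z * norm ((1 - g) * z)" by (rule norm_mult_ineq)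
      also have "\<dots> \<le> e" using n by (simp add: z_def)
      finally have nyz: "norm (y * z) \<le> sqrt e" by (simp add: real_le_rsqrt)
      have nzy: "norm (z * y) \<le> sqrt e" using nyz norm_star[of "y * z"] by (simp add: star_mult sz y(1))
      \<comment> \<open>Split 1 as \<open>(1 - D a) + D a\<close> between the two factors
        \<open>z\<close>. In the part from \<open>D a\<close>, each summand has a \<open>y\<close>
        next to a \<open>z\<close>.\<close>
      have "z * z = z * (1 - D a) * z - r *\<^sub>R (z * D y * (y * z) + z * y * (D y * z))"
        unfolding Da by (simp add: algebra_simps)
      then have "1 \<le> norm (z * (1 - D a) * z) + r * norm (z * D y * (y * z) + z * y * (D y * z))"
        using norm_triangle_ineq4[of "z * (1 - D a) * z"] nz r by (metis abs_of_pos norm_scaleR)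
      also have "norm (z * (1 - D a) * z) \<le> norm (1 - D a)"
        using norm_mult_ineq[of "z * (1 - D a)" z] norm_mult_ineq[of z "1 - D a"] by (simp add: nz)
      also have "norm (z * D y * (y * z) + z * y * (D y * z)) \<le> norm (D y) * sqrt e + sqrt e * norm (D y)"
      proof (rule norm_triangle_le, rule add_mono)
        have "norm (z * D y) \<le> norm (D y)" "norm (D y * z) \<le> norm (D y)"
          using norm_mult_ineq[of z "D y"] norm_mult_ineq[of "D y" z] by (simp_all add: nz)
        then show "norm (z * D y * (y * z)) \<le> norm (D y) * sqrt e" "norm (z * y * (D y * z)) \<le> sqrt e * norm (D y)"
          using nyz nzy by (meson mult_mono norm_ge_zero norm_mult_ineq order_trans)+
      qed
      finally show ?thesis using r by (simp add: algebra_simps)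
    qed
    define f where "f k = norm (1 - D a) + 2 * r * norm (D y) * sqrt (inverse (real (Suc k)))" for k
    have "f \<longlonglongrightarrow> norm (1 - D a) + 2 * r * norm (D y) * sqrt 0"
      unfolding f_def by (intro tendsto_intros LIMSEQ_inverse_real_of_nat)
    moreover have "1 \<le> f k" for k unfolding f_def by (intro key) simp
    ultimately show ?thesis using LIMSEQ_le_const[of f _ 1] by auto
  qed
qed

end

section \<open>Jordan triple derivations and boundedness of derivations\<close>

text \<open>The Leibniz defect \<open>t a b\<close> is antisymmetric, and primeness makes it vanish
  unless \<open>a\<close> and \<open>b\<close> commute. A nonzero defect would even make both
  central, hence be symmetric as well, a contradiction.\<close>

lemma jordan_triple_derivation_prime:
  fixes d :: "'a::real_algebra_1 \<Rightarrow> 'a"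
  assumes add: "\<And>x y. d (x + y) = d x + d y"
    and triple: "\<And>a b. d (a * b * a) = d a * b * a + a * d b * a + a * b * d a"
    and d1: "d 1 = 0"
    and prime: "\<And>s t :: 'a. (\<And>y. s * y * t = 0) \<Longrightarrow> s = 0 \<or> t = 0"
  shows "d (a * b) = d a * b + a * d b"
proof -
  have two: "x = 0" if "x + x = 0" for x :: 'a
    using that by (metis scaleR_2 scaleR_eq_0_iff zero_neq_numeral)
  \<comment> \<open>Linearisation of the triple identity: replace \<open>a\<close> by
    \<open>a + c\<close>.\<close>
  have lin: "d (a * b * c + c * b * a) =
      d a * b * c + a * d b * c + a * b * d c + d c * b * a + c * d b * a + c * b * d a" for a b c
  proof -
    have "(a + c) * b * (a + c) = a * b * a + c * b * c + (a * b * c + c * b * a)"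
      by (simp add: algebra_simps)
    then have "d (a * b * c + c * b * a) = d ((a + c) * b * (a + c)) - d (a * b * a) - d (c * b * c)"
      by (simp add: add)
    then show ?thesis unfolding triple add by (simp add: algebra_simps)
  qed
  define t where "t a b = d (a * b) - d a * b - a * d b" for a b
  have anti: "t b a = - t a b" for a b
  proof -
    have "d (a * b) + d (b * a) = d a * b + a * d b + d b * a + b * d a"
      using lin[of a 1 b] by (simp add: d1 add)
    then have "t a b + t b a = 0" by (simp add: t_def algebra_simps)
    then show ?thesis by (simp add: add_eq_0_iff)
  qed
  have tadd: "t a (b + c) = t a b + t a c" for a b c
    by (simp add: t_def add algebra_simps)
  have ident: "t a b * x * (b * a - a * b) + (b * a - a * b) * x * t a b = 0" for a b x
  proof -
    have dab: "d (a * b) = t a b + d a * b + a * d b" by (simp add: t_def)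
    have dba: "d (b * a) = - t a b + d b * a + b * d a" using anti[of b a] by (simp add: t_def) (simp add: algebra_simps)
    \<comment> \<open>One element is read in two ways: as a linearised triple with outer factors
      \<open>a * b\<close> and \<open>b * a\<close>, and as a sum of two nested triples. Comparing
      the values of \<open>d\<close> leaves only the defects.\<close>
    have "(a * b) * x * (b * a) + (b * a) * x * (a * b) = a * (b * x * b) * a + b * (a * x * a) * b"
      by (simp add: mult.assoc)
    then have "d ((a * b) * x * (b * a) + (b * a) * x * (a * b)) = d (a * (b * x * b) * a) + d (b * (a * x * a) * b)"
      by (simp add: add)
    then show ?thesis unfolding lin triple dab dba by (simp add: algebra_simps)
  qed
  have alt: "t a b = 0 \<or> b * a = a * b" for a b
  proof -
    define u where "u = t a b"
    define c where "c = b * a - a * b"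
    have uc: "c * x * u = - (u * x * c)" for x
      using ident[of a b x] unfolding u_def c_def by (simp add: add_eq_0_iff)
    \<comment> \<open>Three uses of \<open>uc\<close> move the factors around until the product
      equals its own negative.\<close>
    have "u * x * (c * y * u) = 0" for x y
    proof -
      have "u * x * (c * y * u) = - (u * (x * u * y) * c)" unfolding uc[of y] by (simp add: mult.assoc)
      also have "\<dots> = c * x * u * (y * u)" using uc[of "x * u * y"] by (simp add: mult.assoc)
      also have "\<dots> = - (u * x * (c * y * u))" unfolding uc[of x] by (simp add: mult.assoc)
      finally show ?thesis by (intro two[OF iffD1[OF eq_neg_iff_add_eq_0]])
    qed
    then have "u = 0 \<or> c * y * u = 0" for y by (rule prime)
    then have "u = 0 \<or> c = 0" using prime[of c u] by auto
    then show ?thesis by (auto simp: u_def c_def)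
  qed
  \<comment> \<open>If \<open>z\<close> fails to commute with \<open>a\<close>, then
    \<open>t a z = 0\<close>, so both \<open>b\<close> and \<open>b + z\<close> have nonzero defect
    with \<open>a\<close> and commute with it; hence so does \<open>z\<close>.\<close>
  have central: "z * a = a * z" if nz: "t a b \<noteq> 0" for a b z
  proof (rule ccontr)
    assume neq: "z * a \<noteq> a * z"
    then have "t a z = 0" using alt by blast
    then have "t a (b + z) \<noteq> 0" using nz by (simp add: tadd)
    then have "(b + z) * a = a * (b + z)" "b * a = a * b" using alt nz by blast+
    then show False using neq by (simp add: algebra_simps)
  qed
  have "t a b = 0"
  proof (rule ccontr)
    assume nz: "t a b \<noteq> 0"
    then have "t b a \<noteq> 0" using anti[of b a] by simp
    have "t a b = t b a"
      using central[OF nz, of b] central[OF nz, of "d b"] central[OF \<open>t b a \<noteq> 0\<close>, of "d a"]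
      by (simp add: t_def)
    then have "t a b + t a b = 0" using anti[of a b] by (metis add.right_inverse)
    then show False using nz two by blast
  qed
  then show ?thesis by (simp add: t_def algebra_simps)
qed

section \<open>Primeness and boundedness of derivations on simple C*-algebras\<close>

context cstar
begin

text \<open>For fixed \<open>t\<close>, the elements \<open>s\<close> annihilating in this way form
  a closed two-sided ideal; if it contains 1, then \<open>t = 0\<close>.\<close>

lemma simple_imp_prime:
  fixes s t :: 'a
  assumes "simple_algebra sm" and st: "\<And>y. s * y * t = 0"
  shows "s = 0 \<or> t = 0"
proof -
  define I where "I = {s. \<forall>y. s * y * t = 0}"
  have "I = (\<Inter>y. {s. s * y * t = 0})" by (auto simp: I_def)
  moreover have "closed {s. s * y * t = 0}" for y
    by (intro closed_Collect_eq continuous_intros)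
  ultimately have "closed I" by auto
  moreover have "sm c 0 = 0" for c using norm_sm[of c 0] by simp
  moreover have "a * x * y * t = 0 \<and> x * a * y * t = 0" if "\<forall>y. x * y * t = 0" for a x y
    using that[rule_format, of y] that[rule_format, of "a * y"] by (simp add: mult.assoc)
  ultimately have "closed_ideal sm I"
    unfolding closed_ideal_def by (auto simp: I_def distrib_right sm_mult_left)
  then have "I = {0} \<or> I = UNIV" using assms by (simp add: simple_algebra_def)
  moreover have "s \<in> I" using st by (simp add: I_def)
  moreover have "t = 0" if "I = UNIV"
  proof -
    have "1 \<in> I" using that by simp
    then have "1 * 1 * t = 0" unfolding I_def by blast
    then show ?thesis by simp
  qed
  ultimately show ?thesis by auto
qed

lemma
  assumes "linear_derivation sm D"
  shows derivation_add: "D (x + y) = D x + D y"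
    and derivation_sm: "D (sm c x) = sm c (D x)"
    and derivation_mult: "D (x * y) = D x * y + x * D y"
    and derivation_linear: "linear D"
proof -
  show 1: "D (x + y) = D x + D y" and 2: "D (sm c x) = sm c (D x)" and "D (x * y) = D x * y + x * D y" for x y c
    using assms by (auto simp: linear_derivation_def complex_linear_def)
  show "linear D"
    by (rule linearI) (simp_all add: 1 2 flip: sm_of_real)
qed

lemma linear_derivation_comb:
  assumes D: "linear_derivation sm D" and E: "linear_derivation sm E"
  shows "linear_derivation sm (\<lambda>x. sm c (D x) + sm d (E x))"
  unfolding linear_derivation_def complex_linear_def
  by (simp add: derivation_add[OF D] derivation_add[OF E] derivation_sm[OF D] derivation_sm[OF E]
      derivation_mult[OF D] derivation_mult[OF E] sm_add_right sm_sm sm_mult_left sm_mult_right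
      algebra_simps)

text \<open>The order of products is reversed twice. This conjugate serves to split a derivation
  into two that commute with the involution.\<close>

lemma linear_derivation_conj:
  assumes D: "linear_derivation sm D"
  shows "linear_derivation sm (\<lambda>x. star (D (star x)))"
  unfolding linear_derivation_def complex_linear_def
  by (simp add: derivation_add[OF D] derivation_sm[OF D] derivation_mult[OF D] star_add star_sm star_mult)

text \<open>The separating space of the derivation is a closed ideal, so by simplicity it is 0 (and the
  closed graph theorem applies) or contains 1.\<close>

lemma star_derivation_bounded:
  assumes simple: "simple_algebra sm" and D: "linear_derivation sm D"
    and Ds: "\<And>x. D (star x) = star (D x)"
  obtains K where "K \<ge> 0" "\<And>x. norm (D x) \<le> K * norm x"
proof -
  note lin = derivation_linear[OF D]
  define S where "S = {c. \<exists>a. a \<longlonglongrightarrow> 0 \<and> (\<lambda>n. D (a n)) \<longlonglongrightarrow> c}"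
  have S: "c \<in> S" if "a \<longlonglongrightarrow> 0" "(\<lambda>n. D (a n)) \<longlonglongrightarrow> c" for a c
    using that by (auto simp: S_def)
  have "closed_ideal sm S"
    unfolding closed_ideal_def
  proof (intro conjI ballI allI)
    show "0 \<in> S" by (rule S[of "\<lambda>_. 0"]) (auto simp: linear_0[OF lin])
    show "closed S"
    proof (rule closure_subset_eq[THEN iffD1], rule subsetI)
      fix c assume c: "c \<in> closure S"
      \<comment> \<open>One \<open>e\<close> pays for passing from \<open>c\<close> to a nearby
        point of \<open>S\<close>, the other for approximating that point by a value of
        \<open>D\<close>.\<close>
      have "\<exists>a. norm a < e \<and> norm (D a - c) < 2 * e" if e: "e > 0" for e
      proof -
        obtain c' where c': "c' \<in> S" "dist c' c < e" using c e unfolding closure_approachable by blast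
        then obtain f where f: "f \<longlonglongrightarrow> 0" "(\<lambda>n. D (f n)) \<longlonglongrightarrow> c'" by (auto simp: S_def)
        have "\<forall>\<^sub>F n in sequentially. dist (f n) 0 < e \<and> dist (D (f n)) c' < e"
          using f e by (intro eventually_conj tendstoD)
        then obtain n where "dist (f n) 0 < e" "dist (D (f n)) c' < e"
          using eventually_happens'[OF sequentially_bot] by blast
        with c' dist_triangle_less_add[of "D (f n)" c' e c e] show ?thesis
          by (intro exI[of _ "f n"]) (auto simp: dist_norm norm_minus_commute)
      qed
      then have "\<forall>n. \<exists>a. norm a < inverse (real (Suc n)) \<and> norm (D a - c) < 2 * inverse (real (Suc n))"
        by simp
      then obtain a where a: "\<And>n. norm (a n) < inverse (real (Suc n)) \<and> norm (D (a n) - c) < 2 * inverse (real (Suc n))"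
        by metis
      have "a \<longlonglongrightarrow> 0"
        by (rule Lim_null_comparison[OF _ LIMSEQ_inverse_real_of_nat])
          (use a in \<open>auto intro!: always_eventually less_imp_le\<close>)
      moreover have "(\<lambda>n. D (a n) - c) \<longlonglongrightarrow> 0"
      proof (rule Lim_null_comparison)
        show "(\<lambda>n. 2 * inverse (real (Suc n))) \<longlonglongrightarrow> 0"
          using tendsto_mult_left[OF LIMSEQ_inverse_real_of_nat, of 2] by simp
      qed (use a in \<open>auto intro!: always_eventually less_imp_le\<close>)
      ultimately show "c \<in> S" by (intro S[of a]) (simp_all add: LIM_zero_iff)
    qed
  next
    fix c d assume "c \<in> S" "d \<in> S"
    then obtain f g where "f \<longlonglongrightarrow> 0" "(\<lambda>n. D (f n)) \<longlonglongrightarrow> c" "g \<longlonglongrightarrow> 0" "(\<lambda>n. D (g n)) \<longlonglongrightarrow> d"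
      by (auto simp: S_def)
    then show "c + d \<in> S"
      using tendsto_add[of f 0 _ g 0] by (intro S[of "\<lambda>n. f n + g n"]) (auto simp: derivation_add[OF D] intro: tendsto_add)
  next
    fix k c assume "c \<in> S"
    then obtain f where f: "f \<longlonglongrightarrow> 0" "(\<lambda>n. D (f n)) \<longlonglongrightarrow> c" by (auto simp: S_def)
    then have "(\<lambda>n. sm k (f n)) \<longlonglongrightarrow> sm k 0" "(\<lambda>n. sm k (D (f n))) \<longlonglongrightarrow> sm k c"
      by (auto intro: bounded_linear.tendsto[OF bounded_linear_sm])
    then show "sm k c \<in> S"
      using norm_sm[of k 0] by (intro S[of "\<lambda>n. sm k (f n)"]) (auto simp: derivation_sm[OF D])
  next
    fix b c assume "c \<in> S"
    then obtain f where f: "f \<longlonglongrightarrow> 0" "(\<lambda>n. D (f n)) \<longlonglongrightarrow> c" by (auto simp: S_def)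
    \<comment> \<open>In the Leibniz rule the terms where \<open>D\<close> hits the fixed factor
      \<open>b\<close> tend to 0.\<close>
    have "(\<lambda>n. b * f n) \<longlonglongrightarrow> b * 0" "(\<lambda>n. D b * f n + b * D (f n)) \<longlonglongrightarrow> D b * 0 + b * c"
      "(\<lambda>n. f n * b) \<longlonglongrightarrow> 0 * b" "(\<lambda>n. D (f n) * b + f n * D b) \<longlonglongrightarrow> c * b + 0 * D b"
      by (intro tendsto_intros f)+
    then show "b * c \<in> S" "c * b \<in> S"
      using S[of "\<lambda>n. b * f n" "b * c"] S[of "\<lambda>n. f n * b" "c * b"]
      by (simp_all add: derivation_mult[OF D])
  qed
  moreover have "1 \<notin> S"
  proof
    assume "1 \<in> S"
    then obtain f where f: "f \<longlonglongrightarrow> 0" "(\<lambda>n. D (f n)) \<longlonglongrightarrow> 1" by (auto simp: S_def)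
    \<comment> \<open>Self-adjoint parts have the same limits, since \<open>D\<close> commutes with
      the involution; \<open>derivation_not_close_to_one\<close> then applies to them.\<close>
    define g where "g n = (1/2) *\<^sub>R (f n + star (f n))" for n
    note st = bounded_linear.tendsto[OF bounded_linear_star]
    have "g \<longlonglongrightarrow> (1/2) *\<^sub>R (0 + star 0)"
      unfolding g_def by (intro tendsto_intros f st)
    then have g: "g \<longlonglongrightarrow> 0" by (simp add: star_0)
    have "(\<lambda>n. (1/2) *\<^sub>R (D (f n) + star (D (f n)))) \<longlonglongrightarrow> (1/2) *\<^sub>R (1 + star 1)"
      by (intro tendsto_intros f st)
    moreover have "(1/2) *\<^sub>R (1 + star 1) = 1" by (simp flip: scaleR_2)
    ultimately have Dg: "(\<lambda>n. D (g n)) \<longlonglongrightarrow> 1"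
      by (simp add: g_def linear_scale[OF lin] linear_add[OF lin] Ds)
    have "\<forall>\<^sub>F n in sequentially. dist (g n) 0 < 1 \<and> dist (D (g n)) 1 < 1"
      using g Dg by (intro eventually_conj tendstoD) auto
    then obtain n where n: "dist (g n) 0 < 1" "dist (D (g n)) 1 < 1"
      using eventually_happens'[OF sequentially_bot] by blast
    have "norm (1 - D (g n)) \<ge> 1"
      using n(1) by (intro derivation_not_close_to_one lin derivation_mult[OF D])
        (simp_all add: g_def star_scaleR star_add add.commute)
    then show False using n(2) by (simp add: dist_norm norm_minus_commute)
  qed
  ultimately have "S = {0}" using simple unfolding simple_algebra_def by blast
  then have "\<And>a c. \<lbrakk>a \<longlonglongrightarrow> 0; (\<lambda>n. D (a n)) \<longlonglongrightarrow> c\<rbrakk> \<Longrightarrow> c = 0" using S by blast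
  then show thesis using closed_graph_bounded[OF lin] that by blast
qed

text \<open>\<open>D = D1 + \<i> D2\<close>, where both parts commute with the involution.\<close>

lemma derivation_bounded:
  assumes simple: "simple_algebra sm" and D: "linear_derivation sm D"
  obtains K where "K \<ge> 0" "\<And>x. norm (D x) \<le> K * norm x"
proof -
  define D1 where "D1 x = sm (1/2) (D x) + sm (1/2) (star (D (star x)))" for x
  define D2 where "D2 x = sm (-\<i>/2) (D x) + sm (\<i>/2) (star (D (star x)))" for x
  have "linear_derivation sm D1" "linear_derivation sm D2"
    unfolding D1_def D2_def by (intro linear_derivation_comb D linear_derivation_conj)+
  moreover have "D1 (star x) = star (D1 x)" "D2 (star x) = star (D2 x)" for x
    by (simp_all add: D1_def D2_def star_add star_sm add.commute)
  ultimately obtain K1 K2 where K: "K1 \<ge> 0" "\<And>x. norm (D1 x) \<le> K1 * norm x"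
    "K2 \<ge> 0" "\<And>x. norm (D2 x) \<le> K2 * norm x"
    using star_derivation_bounded[OF simple, of D1] star_derivation_bounded[OF simple, of D2] by metis
  have "D x = D1 x + sm \<i> (D2 x)" for x
  proof -
    have "D1 x + sm \<i> (D2 x) = sm (1/2 + 1/2) (D x) + (sm (1/2) (star (D (star x))) + sm (- (1/2)) (star (D (star x))))"
      unfolding sm_add_left by (simp add: D1_def D2_def sm_add_right sm_sm)
    then show ?thesis by (simp add: sm_minus_left)
  qed
  then have "norm (D x) \<le> (K1 + K2) * norm x" for x
    using norm_triangle_ineq[of "D1 x" "sm \<i> (D2 x)"] K(2)[of x] K(4)[of x]
    by (simp add: norm_sm distrib_right)
  then show thesis using that[of "K1 + K2"] K by auto
qed

lemma cartesian_decomposition: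
  obtains h k where "star h = h" "star k = k" "x = h + sm \<i> k" "norm h \<le> norm x" "norm k \<le> norm x"
proof -
  define h where "h = sm (1/2) x + sm (1/2) (star x)"
  define k where "k = sm (-\<i>/2) x + sm (\<i>/2) (star x)"
  have "star h = h" "star k = k"
    by (simp_all add: h_def k_def star_add star_sm add.commute)
  moreover have "x = h + sm \<i> k"
  proof -
    have "h + sm \<i> k = sm (1/2 + 1/2) x + (sm (1/2) (star x) + sm (- (1/2)) (star x))"
      unfolding sm_add_left by (simp add: h_def k_def sm_add_right sm_sm)
    then show ?thesis by (simp add: sm_minus_left)
  qed
  moreover have "norm h \<le> norm x" "norm k \<le> norm x"
    unfolding h_def k_def by (rule order_trans[OF norm_triangle_ineq], simp add: norm_sm norm_divide)+
  ultimately show thesis by (rule that)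
qed

end

section \<open>Tracial states\<close>

locale tracial_cstar = cstar sm star
  for sm :: "complex \<Rightarrow> 'a::{real_normed_algebra_1,banach} \<Rightarrow> 'a" and star :: "'a \<Rightarrow> 'a" +
  fixes tau :: "'a \<Rightarrow> complex"
  assumes trace: "faithful_tracial_state sm star tau"
begin

lemma tau_add: "tau (x + y) = tau x + tau y"
  and tau_sm: "tau (sm c x) = c * tau x"
  and tau_positive: "Im (tau (star x * x)) = 0" "Re (tau (star x * x)) \<ge> 0"
  and tau_1: "tau 1 = 1"
  and tau_commute: "tau (a * b) = tau (b * a)"
  and tau_faithful: "tau (star x * x) = 0 \<Longrightarrow> x = 0"
  using trace unfolding faithful_tracial_state_def by blast+

lemma tau_minus: "tau (- x) = - tau x"
  using tau_sm[of "-1" x] by (simp add: sm_minus_1)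

lemma tau_diff: "tau (x - y) = tau x - tau y"
  using tau_add[of x "- y"] by (simp add: tau_minus)

lemma tau_scaleR: "tau (r *\<^sub>R x) = of_real r * tau x"
  by (simp add: tau_sm flip: sm_of_real)

lemma tau_nondegenerate:
  assumes "\<And>b. tau (x * b) = 0"
  shows "x = 0"
  using assms[of "star x"] by (intro tau_faithful) (simp add: tau_commute)

text \<open>For a self-adjoint contraction \<open>x\<close>, \<open>1 - x\<close> is a square of a
  self-adjoint element, so positivity bounds \<open>tau x\<close> by 1. The factor 2 comes from
  adding real and imaginary parts.\<close>

lemma tau_bounded: "cmod (tau x) \<le> 2 * norm x"
proof -
  have unit: "Im (tau x) = 0 \<and> Re (tau x) \<le> 1" if x: "star x = x" "norm x \<le> 1" for x
  proof -
    obtain y where y: "star y = y" "(1 - y) * (1 - y) = 1 - x"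
      using sqrt_one_minus[OF x] by metis
    then have "star (1 - y) * (1 - y) = 1 - x" by (simp add: star_diff)
    with tau_positive[of "1 - y"] show ?thesis by (simp add: tau_diff tau_1)
  qed
  have unit': "cmod (tau x) \<le> 1" if x: "star x = x" "norm x \<le> 1" for x
    using unit[OF x] unit[of "-x"] x by (simp add: star_neg tau_minus cmod_eq_Re abs_le_iff)
  have sa: "cmod (tau x) \<le> norm x" if x: "star x = x" for x
  proof (cases "x = 0")
    case True then show ?thesis using tau_scaleR[of 0 0] by simp
  next
    case False
    have "cmod (tau ((1 / norm x) *\<^sub>R x)) \<le> 1"
      using False x by (intro unit') (simp_all add: star_scaleR)
    then show ?thesis using False by (simp add: tau_scaleR norm_mult norm_divide field_simps)
  qed
  obtain h k where hk: "star h = h" "star k = k" "x = h + sm \<i> k" "norm h \<le> norm x" "norm k \<le> norm x"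
    using cartesian_decomposition by metis
  have "cmod (tau x) \<le> cmod (tau h) + cmod (tau k)"
    using norm_triangle_ineq[of "tau h" "\<i> * tau k"] hk(3) by (simp add: tau_add tau_sm norm_mult)
  then show ?thesis using sa[OF hk(1)] sa[OF hk(2)] hk(4,5) by linarith
qed

text \<open>\<open>\<tau> (u\<^sup>* D u)\<close> is additive along powers of \<open>u\<close>, yet \<open>u\<^sup>N\<close> stays in the unit ball.\<close>

lemma tau_unitary_derivation:
  assumes simple: "simple_algebra sm" and D: "linear_derivation sm D"
    and u: "star u * u = 1" "u * star u = 1"
  shows "tau (star u * D u) = 0"
proof -
  obtain K where K: "K \<ge> 0" "\<And>x. norm (D x) \<le> K * norm x"
    using derivation_bounded[OF simple D] by metis
  have uu: "u ^ N * star u ^ N = 1" for N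
  proof (induction N)
    case (Suc N)
    have "u ^ Suc N * star u ^ Suc N = u * (u ^ N * star u ^ N) * star u"
      by (simp only: power_Suc[of u] power_Suc2[of "star u"] mult.assoc)
    then show ?case by (simp add: Suc u)
  qed simp
  have D1: "D 1 = 0" using derivation_mult[OF D, of 1 1] by simp
  have power: "tau (star u ^ N * D (u ^ N)) = of_nat N * tau (star u * D u)" for N
  proof (induction N)
    case 0
    then show ?case using tau_scaleR[of 0 0] by (simp add: D1)
  next
    case (Suc N)
    have "star u ^ Suc N * D (u ^ Suc N) = star u ^ Suc N * D u * u ^ N + star u ^ N * (star u * u) * D (u ^ N)"
      by (simp only: power_Suc[of u] power_Suc2[of "star u"] derivation_mult[OF D] distrib_left mult.assoc)
    \<comment> \<open>Cyclicity brings \<open>u ^ N\<close> to the front, where it cancels all but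
      one factor \<open>star u\<close>.\<close>
    then have "tau (star u ^ Suc N * D (u ^ Suc N)) = tau (u ^ N * (star u ^ Suc N * D u)) + tau (star u ^ N * D (u ^ N))"
      by (simp only: u mult_1_right tau_add tau_commute[of "star u ^ Suc N * D u"])
    also have "u ^ N * (star u ^ Suc N * D u) = (u ^ N * star u ^ N) * (star u * D u)"
      by (simp only: power_Suc2 mult.assoc)
    finally show ?case by (simp add: uu Suc algebra_simps)
  qed
  have nu: "norm u = 1" using u by (intro norm_unitary)
  have bd: "real N * cmod (tau (star u * D u)) \<le> 2 * K" for N
  proof -
    have n1: "norm (u ^ N) \<le> 1" "norm (star u ^ N) \<le> 1"
      using norm_power_ineq[of u N] norm_power_ineq[of "star u" N] nu by simp_all
    have "real N * cmod (tau (star u * D u)) = cmod (tau (star u ^ N * D (u ^ N)))"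
      by (simp add: power norm_mult)
    also have "\<dots> \<le> 2 * norm (star u ^ N * D (u ^ N))" by (rule tau_bounded)
    also have "norm (star u ^ N * D (u ^ N)) \<le> norm (star u ^ N) * norm (D (u ^ N))" by (rule norm_mult_ineq)
    also have "\<dots> \<le> 1 * (K * 1)"
      using n1 K by (intro mult_mono order_trans[OF K(2)]) (auto intro: mult_left_le)
    finally show ?thesis by simp
  qed
  show ?thesis
  proof (rule ccontr)
    assume "tau (star u * D u) \<noteq> 0"
    then obtain N where "2 * K < real N * cmod (tau (star u * D u))"
      using ex_less_of_nat_mult[of "cmod (tau (star u * D u))"] by auto
    with bd[of N] show False by simp
  qed
qed

text \<open>For self-adjoint \<open>k\<close>, differentiate \<open>tau (star u * D u) = 0\<close>
  along unitaries \<open>u\<close> near 1 with imaginary part \<open>e *\<^sub>R k\<close>: the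
  first-order term is a multiple of \<open>tau (D k)\<close>.\<close>

lemma tau_derivation:
  assumes simple: "simple_algebra sm" and D: "linear_derivation sm D"
  shows "tau (D x) = 0"
proof -
  note lin = derivation_linear[OF D]
  obtain K where K: "K \<ge> 0" "\<And>x. norm (D x) \<le> K * norm x"
    using derivation_bounded[OF simple D] by metis
  have D1: "D 1 = 0" using derivation_mult[OF D, of 1 1] by simp
  have unit: "tau (D k) = 0" if k: "star k = k" "norm k \<le> 1" for k
  proof -
    \<comment> \<open>Of the 10, 2 comes from \<open>D y\<close> and 8 from the product
      \<open>(y + sm \<i> t) * D u\<close>, both of order \<open>e * e\<close>.\<close>
    have est: "cmod (tau (D k)) \<le> 10 * K * e" if e: "0 < e" "e \<le> 1" for e
    proof -
      define t where "t = e *\<^sub>R k"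
      have t: "star t = t" "norm t \<le> e" using k e by (simp_all add: t_def star_scaleR mult_left_le)
      have e2: "e * e \<le> e" using e by (simp add: mult_left_le)
      have tt: "norm (t * t) \<le> e * e"
        using norm_mult_ineq[of t t] mult_mono[OF t(2) t(2)] e by simp
      have "star (t * t) = t * t" by (simp add: star_mult t)
      moreover have "norm (t * t) \<le> 1" using tt e2 e(2) by linarith
      ultimately obtain y where y: "star y = y" "(1 - y) * (1 - y) = 1 - t * t" "norm y \<le> norm (t * t)"
        and yc: "\<And>z. z * (t * t) = t * t * z \<Longrightarrow> z * y = y * z"
        using sqrt_one_minus by metis
      \<comment> \<open>\<open>1 - y\<close> is the square root of \<open>1 - t * t\<close>, so
        \<open>y\<close> is of second order in \<open>e\<close>.\<close>
      define u where "u = (1 - y) + sm \<i> t"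
      have "t * y = y * t" by (rule yc) (simp add: mult.assoc)
      then have s: "star (1 - y) = 1 - y" "(1 - y) * t = t * (1 - y)" "(1 - y) * (1 - y) + t * t = 1"
        using y by (simp_all add: star_diff left_diff_distrib right_diff_distrib)
      note u = unitary_of_commuting[OF s(1) t(1) s(2,3), folded u_def]
      have Du: "D u = sm \<i> (e *\<^sub>R D k) - D y"
        by (simp add: u_def t_def derivation_add[OF D] linear_diff[OF lin] D1 derivation_sm[OF D] linear_scale[OF lin])
      have ny: "norm y \<le> e * e" "norm y \<le> e" using y(3) tt e2 by linarith+
      have nDy: "norm (D y) \<le> K * (e * e)"
        using K(2)[of y] mult_left_mono[OF ny(1) K(1)] by linarith
      have nDk: "norm (D k) \<le> K"
        using K(2)[of k] mult_left_mono[OF k(2) K(1)] by linarith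
      have nDu: "norm (D u) \<le> 2 * K * e"
      proof -
        have "norm (D u) \<le> e * norm (D k) + norm (D y)"
          unfolding Du using norm_triangle_ineq4[of "sm \<i> (e *\<^sub>R D k)" "D y"] e by (simp add: norm_sm)
        also have "\<dots> \<le> e * K + K * e"
          using nDk e mult_left_mono[OF e2 K(1)] nDy by (intro add_mono mult_left_mono) auto
        finally show ?thesis by (simp add: algebra_simps)
      qed
      have n2: "norm (y + sm \<i> t) \<le> 2 * e"
        using norm_triangle_ineq[of y "sm \<i> t"] ny(2) t(2) by (simp add: norm_sm)
      have "star u * D u = sm \<i> (e *\<^sub>R D k) - D y - (y + sm \<i> t) * D u"
        unfolding u(1) by (simp add: algebra_simps Du)
      then have "tau (star u * D u) = \<i> * (of_real e * tau (D k)) - (tau (D y) + tau ((y + sm \<i> t) * D u))"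
        by (simp add: tau_diff tau_sm tau_scaleR)
      then have "\<i> * (of_real e * tau (D k)) = tau (D y) + tau ((y + sm \<i> t) * D u)"
        using tau_unitary_derivation[OF simple D u(2,3)] by simp
      then have "e * cmod (tau (D k)) = cmod (tau (D y) + tau ((y + sm \<i> t) * D u))"
        using e by (metis abs_of_pos mult.left_neutral norm_ii norm_mult norm_of_real)
      also have "\<dots> \<le> 2 * norm (D y) + 2 * norm ((y + sm \<i> t) * D u)"
        by (intro norm_triangle_le add_mono tau_bounded)
      also have "norm ((y + sm \<i> t) * D u) \<le> (2 * e) * (2 * K * e)"
        using norm_mult_ineq[of "y + sm \<i> t" "D u"] mult_mono[OF n2 nDu] e by simp
      finally have "e * cmod (tau (D k)) \<le> e * (10 * K * e)"
        using nDy by (simp add: algebra_simps)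
      then show ?thesis using e by simp
    qed
    have "cmod (tau (D k)) \<le> 0"
    proof (rule LIMSEQ_le_const)
      show "(\<lambda>n. 10 * K * inverse (real (Suc n))) \<longlonglongrightarrow> 0"
        using tendsto_mult_left[OF LIMSEQ_inverse_real_of_nat, of "10 * K"] by simp
      show "\<exists>N. \<forall>n\<ge>N. cmod (tau (D k)) \<le> 10 * K * inverse (real (Suc n))"
        by (intro exI allI impI est) (auto simp: field_simps)
    qed
    then show ?thesis by simp
  qed
  have sa: "tau (D k) = 0" if k: "star k = k" for k
  proof (cases "k = 0")
    case True then show ?thesis using tau_scaleR[of 0 0] by (simp add: linear_0[OF lin])
  next
    case False
    have "tau (D ((1 / norm k) *\<^sub>R k)) = 0"
      using False k by (intro unit) (simp_all add: star_scaleR)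
    then show ?thesis using False by (simp add: tau_scaleR linear_scale[OF lin])
  qed
  obtain h k where hk: "star h = h" "star k = k" "x = h + sm \<i> k"
    using cartesian_decomposition by metis
  then show ?thesis using sa by (simp add: derivation_add[OF D] derivation_sm[OF D] tau_add tau_sm)
qed

end

section \<open>Linearity and the Leibniz rule for \<open>phi\<close>\<close>

theorem theorem3p2:
  fixes sm :: "complex \<Rightarrow> 'a::{real_normed_algebra_1,banach} \<Rightarrow> 'a"
    and star :: "'a \<Rightarrow> 'a" and tau :: "'a \<Rightarrow> complex" and phi :: "'a \<Rightarrow> 'a"
  assumes "cstar_algebra sm star"
    and "simple_algebra sm"
    and "faithful_tracial_state sm star tau"
    and "\<forall>a b. \<exists>D. linear_derivation sm D \<and> phi a * b + a * phi b = D (a * b)"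
  shows "linear_derivation sm phi"
proof -
  interpret tracial_cstar sm star tau by unfold_locales fact+
  have skew: "tau (phi a * b) = - tau (a * phi b)" for a b
  proof -
    obtain D where "linear_derivation sm D" "phi a * b + a * phi b = D (a * b)" using assms(4) by blast
    then have "tau (phi a * b + a * phi b) = 0" using tau_derivation assms(2) by simp
    then show ?thesis by (simp add: tau_add add_eq_0_iff)
  qed
  \<comment> \<open>Under the trace, skewness moves \<open>phi\<close> onto the test element,
    leaving an expression linear in the argument.\<close>
  have add: "phi (a + b) = phi a + phi b" for a b
  proof -
    have "phi (a + b) - phi a - phi b = 0"
      by (rule tau_nondegenerate) (simp add: left_diff_distrib tau_diff skew distrib_right tau_add)
    then show ?thesis by (simp add: algebra_simps)
  qed
  have scale: "phi (sm c a) = sm c (phi a)" for c a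
  proof -
    have "phi (sm c a) - sm c (phi a) = 0"
      by (rule tau_nondegenerate) (simp add: left_diff_distrib tau_diff skew sm_mult_left tau_sm)
    then show ?thesis by simp
  qed
  have phi1: "phi 1 = 0"
  proof -
    obtain D where D: "linear_derivation sm D" "phi 1 * 1 + 1 * phi 1 = D (1 * 1)" using assms(4) by blast
    then have "phi 1 + phi 1 = 0" using derivation_mult[OF D(1), of 1 1] by simp
    then show ?thesis by (metis scaleR_2 scaleR_eq_0_iff zero_neq_numeral)
  qed
  \<comment> \<open>For \<open>c = a * b\<close>, cyclicity gives
    \<open>tau (D (c * c)) = 2 * tau (D c * c)\<close>, and the left side is 0.\<close>
  have quartic: "tau ((phi a * b + a * phi b) * (a * b)) = 0" for a b
  proof -
    obtain D where D: "linear_derivation sm D" "phi a * b + a * phi b = D (a * b)" using assms(4) by blast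
    have "tau (D ((a * b) * (a * b))) = 0" using tau_derivation assms(2) D by blast
    then have "tau (D (a * b) * (a * b)) + tau (D (a * b) * (a * b)) = 0"
      by (simp only: derivation_mult[OF D(1), of "a * b" "a * b"] tau_add tau_commute[of "a * b" "D (a * b)"])
    then show ?thesis unfolding D(2) by simp
  qed
  have triple: "phi (a * b * a) = phi a * b * a + a * phi b * a + a * b * phi a" for a b
  proof -
    define X where "X = phi a * b * a + a * phi b * a + a * b * phi a - phi (a * b * a)"
    have "tau (X * c) = 0" for c
    proof -
      \<comment> \<open>The quartic identity is quadratic in its second variable; subtracting its
        values at \<open>b\<close> and \<open>c\<close> leaves the mixed terms.\<close>
      have "tau ((phi a * (b + c) + a * phi (b + c)) * (a * (b + c))) 
        - tau ((phi a * b + a * phi b) * (a * b)) - tau ((phi a * c + a * phi c) * (a * c)) = 0"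
        by (simp only: quartic diff_self)
      moreover have "(phi a * (b + c) + a * phi (b + c)) * (a * (b + c)) 
         - (phi a * b + a * phi b) * (a * b) - (phi a * c + a * phi c) * (a * c)
        = phi a * b * a * c + a * phi b * a * c + phi a * (c * (a * b)) + a * (phi c * (a * b))"
        by (simp add: add algebra_simps)
      ultimately have "tau (phi a * b * a * c) + tau (a * phi b * a * c) + tau (phi a * (c * (a * b))) 
          + tau (a * (phi c * (a * b))) = 0"
        by (metis tau_add tau_diff)
      moreover have "tau (phi a * (c * (a * b))) = tau (a * b * phi a * c)"
        using tau_commute[of c "a * b * phi a"] tau_commute[of "phi a" "c * (a * b)"] by (simp add: mult.assoc)
      \<comment> \<open>After a cyclic shift, skewness transfers \<open>phi\<close> from
        \<open>c\<close> to \<open>a * b * a\<close>, so every term becomes a pairing with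
        \<open>c\<close>.\<close>
      moreover have "tau (a * (phi c * (a * b))) = - tau (phi (a * b * a) * c)"
        using tau_commute[of a "phi c * (a * b)"] skew[of c "a * b * a"] tau_commute[of c "phi (a * b * a)"]
        by (simp add: mult.assoc)
      ultimately show ?thesis by (simp add: X_def distrib_right left_diff_distrib tau_add tau_diff)
    qed
    then have "X = 0" by (rule tau_nondegenerate)
    then show ?thesis by (simp add: X_def)
  qed
  have "phi (a * b) = phi a * b + a * phi b" for a b
    using jordan_triple_derivation_prime[OF add triple phi1 simple_imp_prime[OF assms(2)]] by blast
  then show ?thesis by (simp add: linear_derivation_def complex_linear_def add scale)
qed


end
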